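(* Let $\varphi$ be an Orlicz $N$-function satisfying the $Q$-condition and the $\Delta_2$-condition, let $(X_t)_{t\in T}$ be a $\varphi$-sub-Gaussian process with metric $d(s,t)=\tau_\varphi(X_t-X_s)$ on $T$, and let $1\le p<\infty$. Then $$\gamma_{\varphi,p}(T,d)\asymp\tilde\gamma_{\varphi,p}(T,d),$$ that is, there are universal constants $C,C'>0$ such that $\gamma_{\varphi,p}(T,d)\le C\,\tilde\gamma_{\varphi,p}(T,d)$ and $\tilde\gamma_{\varphi,p}(T,d)\le C'\gamma_{\varphi,p}(T,d)$.
   Context: An Orlicz $N$-function is a continuous, even, convex function $\varphi:\mathbb{R}\to\mathbb{R}$ with $\varphi(0)=0$, monotonically increasing on $x>0$, with $\varphi(x)/x\to0$ as $x\to0$ and $\varphi(x)/x\to\infty$ as $x\to\infty$. It satisfies the $Q$-condition if $\liminf_{x\to0}\varphi(x)/x^2=c$ for some constant $c>0$. Its convex conjugate is $\varphi^*(x)=\sup_{y\in\mathbb{R}}(xy-\varphi(y))$, and $\varphi^{*(-1)}$ denotes the inverse function of $\varphi^*$ on $[0,\infty)$. $\varphi$ satisfies the $\Delta_2$-condition if for every $b>1$ there is $M_b\in(0,1)$ with $\varphi^{*(-1)}(bx)/\varphi^{*(-1)}(x)\ge1/(1-M_b)$ for all $x\ge2$. A mean-zero random variable $\xi$ is $\varphi$-sub-Gaussian if there is $a\ge0$ with $\mathsf{E}\exp(\lambda\xi)\le\exp(\varphi(a\lambda))$ for all $\lambda\in\mathbb{R}$; $\tau_\varphi(\xi)$ is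 the infimum of such $a$. A process $(X_t)_{t\in T}$ is $\varphi$-sub-Gaussian if every $X_t$ is; $d(s,t)=\tau_\varphi(X_t-X_s)$ is taken to be a metric on $T$. $\Delta(S)$ is the $d$-diameter of $S$. For $1\le p<\infty$, $k_p=\lfloor\log p/\log2\rfloor$. An admissible sequence of $T$ is an increasing (i.e. successively refining) sequence $(\mathcal{A}_n)_{n\ge0}$ of partitions of $T$ with $\operatorname{card}(\mathcal{A}_0)=1$ and $\operatorname{card}(\mathcal{A}_n)\le2^{2^n}$ for $n\ge1$; $A_n(t)$ is the element of $\mathcal{A}_n$ containing $t$. Define $$\gamma_{\varphi,p}(T,d)=\inf\ \sup_{t\in T}\sum_{n\ge k_p}\varphi^{*(-1)}(2^n)\Delta(A_n(t)),$$ the infimum over all admissible sequences, and $$\tilde\gamma_{\varphi,p}(T,d)=\inf\ \sup_{t\in T}\sum_{n\ge k_p}\varphi^{*(-1)}(2^n)\,d(t,T_n),$$ the infimum over all sequences of subsets $T_n\subset T$ with $\operatorname{card}(T_n)\le2^{2^n}$.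
   Formalization: The point sets must satisfy card(T_0)=1 instead of card(T_0)≤2; as written the claim fails for p<2 on a two-point T. The constants are stated for index set and sample space within fixed types; embedding countably many failing instances into one larger type makes them universal. *)

theory Defs
  imports "HOL-Probability.Probability"
begin

section \<open>Orlicz N-functions\<close>

text \<open>
  Monotonicity is taken in the weak sense; together with the Q-condition and convexity it
  implies strict monotonicity on the positive half-line.
\<close>

definition orlicz_N_function :: "(real \<Rightarrow> real) \<Rightarrow> bool" where
  "orlicz_N_function \<phi> \<longleftrightarrow>
     continuous_on UNIV \<phi> \<and> (\<forall>x. \<phi> (- x) = \<phi> x) \<and> convex_on UNIV \<phi> \<and> \<phi> 0 = 0 \<and>
     mono_on {0<..} \<phi> \<and>
     ((\<lambda>x. \<phi> x / x) \<longlongrightarrow> 0) (at 0) \<and> filterlim (\<lambda>x. \<phi> x / x) at_top at_top"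

definition Q_condition :: "(real \<Rightarrow> real) \<Rightarrow> bool" where
  "Q_condition \<phi> \<longleftrightarrow> (\<exists>c::real. c > 0 \<and> Liminf (at 0) (\<lambda>x. ereal (\<phi> x / x\<^sup>2)) = ereal c)"

text \<open>For an N-function the supremum below is over a bounded set, by superlinear growth.\<close>

definition convex_conjugate :: "(real \<Rightarrow> real) \<Rightarrow> real \<Rightarrow> real" where
  "convex_conjugate \<phi> x = (SUP y. x * y - \<phi> y)"

text \<open>For an N-function the conjugate is a bijection of \<open>[0,\<infinity>)\<close> onto itself.\<close>

definition conjugate_inv :: "(real \<Rightarrow> real) \<Rightarrow> real \<Rightarrow> real" where
  "conjugate_inv \<phi> = inv_into {0..} (convex_conjugate \<phi>)"

definition Delta2_condition :: "(real \<Rightarrow> real) \<Rightarrow> bool" where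
  "Delta2_condition \<phi> \<longleftrightarrow>
     (\<forall>b>1. \<exists>M. 0 < M \<and> M < 1 \<and>
        (\<forall>x\<ge>2. conjugate_inv \<phi> (b * x) / conjugate_inv \<phi> x \<ge> 1 / (1 - M)))"

section \<open>Sub-Gaussian variables and processes\<close>

text \<open>
  Integrability is required explicitly because the Bochner integral of a non-integrable function
  is \<open>0\<close>.
\<close>

definition subgaussian_bounds :: "(real \<Rightarrow> real) \<Rightarrow> 'a measure \<Rightarrow> ('a \<Rightarrow> real) \<Rightarrow> real set" where
  "subgaussian_bounds \<phi> M \<xi> =
     {a. a \<ge> 0 \<and> (\<forall>l. integrable M (\<lambda>\<omega>. exp (l * \<xi> \<omega>)) \<and>
                       (\<integral>\<omega>. exp (l * \<xi> \<omega>) \<partial>M) \<le> exp (\<phi> (a * l)))}"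

definition subgaussian :: "(real \<Rightarrow> real) \<Rightarrow> 'a measure \<Rightarrow> ('a \<Rightarrow> real) \<Rightarrow> bool" where
  "subgaussian \<phi> M \<xi> \<longleftrightarrow>
     integrable M \<xi> \<and> (\<integral>\<omega>. \<xi> \<omega> \<partial>M) = 0 \<and> subgaussian_bounds \<phi> M \<xi> \<noteq> {}"

definition subgaussian_norm :: "(real \<Rightarrow> real) \<Rightarrow> 'a measure \<Rightarrow> ('a \<Rightarrow> real) \<Rightarrow> real" where
  "subgaussian_norm \<phi> M \<xi> = Inf (subgaussian_bounds \<phi> M \<xi>)"

definition subgaussian_process ::
    "(real \<Rightarrow> real) \<Rightarrow> 'a measure \<Rightarrow> 't set \<Rightarrow> ('t \<Rightarrow> 'a \<Rightarrow> real) \<Rightarrow> bool" where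
  "subgaussian_process \<phi> M T X \<longleftrightarrow> (\<forall>t\<in>T. subgaussian \<phi> M (X t))"

text \<open>
  The value \<open>0\<close> outside \<open>T\<close> is a dummy: the locale \<open>Metric_space\<close> demands nonnegativity and
  symmetry on the whole type.
\<close>

definition process_dist ::
    "(real \<Rightarrow> real) \<Rightarrow> 'a measure \<Rightarrow> 't set \<Rightarrow> ('t \<Rightarrow> 'a \<Rightarrow> real) \<Rightarrow> 't \<Rightarrow> 't \<Rightarrow> real" where
  "process_dist \<phi> M T X s t =
     (if s \<in> T \<and> t \<in> T then subgaussian_norm \<phi> M (\<lambda>\<omega>. X t \<omega> - X s \<omega>) else 0)"

section \<open>The chaining functionals\<close>

text \<open>
  Diameters, distances to sets and the functionals are \<open>[0,\<infinity>]\<close>-valued: \<open>T\<close> may be unbounded, and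
  the distance to the empty set and the infimum over the empty family are \<open>\<infinity>\<close>.
\<close>

definition set_diam :: "('t \<Rightarrow> 't \<Rightarrow> real) \<Rightarrow> 't set \<Rightarrow> ennreal" where
  "set_diam d S = (SUP s\<in>S. SUP t\<in>S. ennreal (d s t))"

definition dist_to_set :: "('t \<Rightarrow> 't \<Rightarrow> real) \<Rightarrow> 't \<Rightarrow> 't set \<Rightarrow> ennreal" where
  "dist_to_set d t S = (INF s\<in>S. ennreal (d t s))"

definition start_index :: "real \<Rightarrow> nat" where
  "start_index p = nat \<lfloor>ln p / ln 2\<rfloor>"

definition admissible_sequence :: "'t set \<Rightarrow> (nat \<Rightarrow> 't set set) \<Rightarrow> bool" where
  "admissible_sequence T \<A> \<longleftrightarrow>
     (\<forall>n. partition_on T (\<A> n)) \<and> (\<forall>n. refines T (\<A> (Suc n)) (\<A> n)) \<and>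
     card (\<A> 0) = 1 \<and> (\<forall>n\<ge>1. finite (\<A> n) \<and> card (\<A> n) \<le> 2 ^ (2 ^ n))"

definition part_of :: "'t set set \<Rightarrow> 't \<Rightarrow> 't set" where
  "part_of P t = (THE S. S \<in> P \<and> t \<in> S)"

text \<open>
  The cardinality at level \<open>0\<close> is normalised to \<open>1\<close>, exactly as for partitions. It only matters
  when \<open>start_index p = 0\<close>; allowing \<open>2 ^ 2 ^ 0 = 2\<close> points there would make the point
  functional vanish on every two-point space while the partition functional stays positive.
\<close>

definition admissible_points :: "'t set \<Rightarrow> (nat \<Rightarrow> 't set) \<Rightarrow> bool" where
  "admissible_points T U \<longleftrightarrow>
     (\<forall>n. U n \<subseteq> T) \<and> card (U 0) = 1 \<and> (\<forall>n\<ge>1. finite (U n) \<and> card (U n) \<le> 2 ^ (2 ^ n))"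

definition gamma_part ::
    "(real \<Rightarrow> real) \<Rightarrow> real \<Rightarrow> 't set \<Rightarrow> ('t \<Rightarrow> 't \<Rightarrow> real) \<Rightarrow> ennreal" where
  "gamma_part \<phi> p T d =
     (INF \<A>\<in>{\<A>. admissible_sequence T \<A>}. SUP t\<in>T.
        \<Sum>k. (let n = k + start_index p in
              ennreal (conjugate_inv \<phi> (2 ^ n)) * set_diam d (part_of (\<A> n) t)))"

definition gamma_points ::
    "(real \<Rightarrow> real) \<Rightarrow> real \<Rightarrow> 't set \<Rightarrow> ('t \<Rightarrow> 't \<Rightarrow> real) \<Rightarrow> ennreal" where
  "gamma_points \<phi> p T d =
     (INF U\<in>{U. admissible_points T U}. SUP t\<in>T.
        \<Sum>k. (let n = k + start_index p in
              ennreal (conjugate_inv \<phi> (2 ^ n)) * dist_to_set d t (U n)))"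

end

theory Submission
  imports Defs
begin

text \<open>
  Write \<open>w n = conjugate_inv \<phi> (2 ^ n)\<close> and \<open>k = start_index p\<close>. Passing from partitions to points
  costs nothing: choosing one point in every cell gives sets \<open>U n\<close> with
  \<open>d(t, U n) \<le> \<Delta>(A n t)\<close> (\<open>gamma_points_le_gamma_part\<close>).

  The converse cannot use the Voronoi cells of \<open>U n\<close> alone, because the cell of a point \<open>t\<close> very
  close to \<open>U n\<close> may contain points far from \<open>U n\<close>, and then its diameter is not controlled by
  \<open>d(t, U n)\<close>. So each Voronoi cell at level \<open>m\<close> is cut further according to the order of magnitude
  of the distance to \<open>U m\<close>: with \<open>R\<close> a bound for the distances to the initial set \<open>U k\<close>, the dyadic
  scales \<open>R, R/2, \<dots>, R / 2 ^ (2 * m)\<close> are distinguished. Points in a common piece that also share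
  their nearest point in \<open>U k\<close> are at distance at most
  \<open>4 * d(t, U m) + 2 * R / 4 ^ m\<close>. The cut produces at most \<open>2 * m + 1 \<le> 2 ^ 2 ^ m\<close> pieces per
  Voronoi cell, hence at most \<open>2 ^ 2 ^ (m + 1)\<close> labels at level \<open>m\<close>. Recording all the labels of the
  levels \<open>k, \<dots>, m\<close>, together with the nearest point in \<open>U k\<close>, makes the partitions nested and keeps
  the number of cells at most \<open>2 ^ 2 ^ (m + 2)\<close>; so this record is used at level \<open>m + 2\<close>
  (\<open>admissible_history\<close>).

  Summation uses that \<open>w\<close> is positive and \<open>w (n + 1) \<le> 2 * w n\<close>, which holds because
  \<open>\<phi>\<close> is nonnegative, so that its conjugate \<open>\<psi>\<close> satisfies \<open>\<psi> (c * x) \<ge> c * \<psi> x\<close> for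
  \<open>c \<ge> 1\<close> (\<open>conjugate_inv_double\<close>). The shift by two levels
  then costs a factor \<open>4\<close>, and the error terms \<open>w (m + 2) * 2 * R / 4 ^ m\<close> form a series dominated
  by a geometric one with sum of order \<open>w k * R\<close>. This is at most a multiple of the point sum,
  because \<open>w k * d(t, U k)\<close> is its first term. Adding up gives the constant \<open>38\<close>
  (\<open>partition_from_points\<close>). No constant depends on \<open>\<phi>\<close>, \<open>p\<close> or the metric space.
\<close>

section \<open>The inverse of the conjugate\<close>

text \<open>
  By evenness and convexity, \<open>0 = \<phi> 0 \<le> (\<phi> x + \<phi> (- x)) / 2 = \<phi> x\<close>.
\<close>

lemma orlicz_nonneg:
  assumes "orlicz_N_function \<phi>"
  shows "0 \<le> \<phi> x"
proof -
  have c: "convex_on UNIV \<phi>" and e: "\<phi> (- x) = \<phi> x" and z: "\<phi> 0 = 0"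
    using assms by (auto simp: orlicz_N_function_def)
  have "\<phi> ((1 - 1/2) *\<^sub>R x + (1/2) *\<^sub>R (- x)) \<le> (1 - 1/2) * \<phi> x + (1/2) * \<phi> (- x)"
    by (rule convex_onD[OF c]) auto
  then show ?thesis using e z by simp
qed

text \<open>
  By superlinear growth, \<open>\<phi> y \<ge> \<bar>x\<bar> * \<bar>y\<bar>\<close> once \<open>\<bar>y\<bar>\<close> exceeds some \<open>Y\<close>, where the expression is
  then nonpositive; elsewhere it is at most \<open>\<bar>x\<bar> * Y\<close>. Real suprema of unbounded
  sets are arbitrary, so this is what makes the conjugate meaningful.
\<close>

lemma convex_conjugate_bdd_above:
  assumes "orlicz_N_function \<phi>"
  shows "bdd_above (range (\<lambda>y. x * y - \<phi> y))"
proof -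
  have e: "\<And>x. \<phi> (- x) = \<phi> x" and lim: "filterlim (\<lambda>x. \<phi> x / x) at_top at_top"
    using assms by (auto simp: orlicz_N_function_def)
  from lim have "eventually (\<lambda>y. \<bar>x\<bar> \<le> \<phi> y / y) at_top"
    by (simp add: filterlim_at_top)
  then obtain Y0 where Y0: "\<And>y. y \<ge> Y0 \<Longrightarrow> \<bar>x\<bar> \<le> \<phi> y / y"
    by (auto simp: eventually_at_top_linorder)
  define Y where "Y = max Y0 1"
  have "x * y - \<phi> y \<le> \<bar>x\<bar> * Y" for y
  proof (cases "\<bar>y\<bar> \<ge> Y")
    case True
    then have y: "\<bar>y\<bar> > 0" and "\<bar>x\<bar> \<le> \<phi> \<bar>y\<bar> / \<bar>y\<bar>" by (auto intro: Y0 simp: Y_def)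
    then have "\<bar>x\<bar> * \<bar>y\<bar> \<le> \<phi> \<bar>y\<bar>" by (simp add: field_simps)
    moreover have "\<phi> \<bar>y\<bar> = \<phi> y" using e by (simp add: abs_if)
    moreover have "x * y \<le> \<bar>x\<bar> * \<bar>y\<bar>" by (metis abs_ge_self abs_mult)
    moreover have "0 \<le> \<bar>x\<bar> * Y" by (simp add: Y_def)
    ultimately show ?thesis by linarith
  next
    case False
    have "x * y \<le> \<bar>x\<bar> * \<bar>y\<bar>" by (metis abs_ge_self abs_mult)
    also have "\<dots> \<le> \<bar>x\<bar> * Y" using False by (intro mult_left_mono) auto
    finally show ?thesis using orlicz_nonneg[OF assms, of y] by linarith
  qed
  then show ?thesis by (intro bdd_aboveI[where M = "\<bar>x\<bar> * Y"]) auto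
qed

lemma convex_conjugate_upper:
  assumes "orlicz_N_function \<phi>"
  shows "x * y - \<phi> y \<le> convex_conjugate \<phi> x"
  unfolding convex_conjugate_def
  by (rule cSUP_upper[OF _ convex_conjugate_bdd_above[OF assms]]) simp

lemma convex_conjugate_least:
  assumes "\<And>y. x * y - \<phi> y \<le> z"
  shows "convex_conjugate \<phi> x \<le> z"
  unfolding convex_conjugate_def by (rule cSUP_least) (use assms in auto)

lemma convex_conjugate_0:
  assumes "orlicz_N_function \<phi>"
  shows "convex_conjugate \<phi> 0 = 0"
proof (rule antisym)
  show "convex_conjugate \<phi> 0 \<le> 0"
    by (rule convex_conjugate_least) (use orlicz_nonneg[OF assms] in auto)
  show "0 \<le> convex_conjugate \<phi> 0"
    using convex_conjugate_upper[OF assms, of 0 0] assms by (simp add: orlicz_N_function_def)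
qed

text \<open>
  Multiplying \<open>x * y - \<phi> y\<close> by \<open>c\<close> subtracts \<open>c * \<phi> y \<ge> \<phi> y\<close>. This inequality gives strict
  monotonicity and unboundedness of the conjugate, and the doubling bound for its inverse.
\<close>

lemma convex_conjugate_superhomogeneous:
  assumes "orlicz_N_function \<phi>" "1 \<le> c"
  shows "c * convex_conjugate \<phi> x \<le> convex_conjugate \<phi> (c * x)"
proof -
  have "x * y - \<phi> y \<le> convex_conjugate \<phi> (c * x) / c" for y
  proof -
    have "\<phi> y \<le> c * \<phi> y"
      using mult_right_mono[OF assms(2) orlicz_nonneg[OF assms(1), of y]] by simp
    then have "c * (x * y - \<phi> y) \<le> c * x * y - \<phi> y" by (simp add: algebra_simps)
    also have "\<dots> \<le> convex_conjugate \<phi> (c * x)" by (rule convex_conjugate_upper[OF assms(1)])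
    finally show ?thesis using assms(2) by (simp add: field_simps)
  qed
  then have "convex_conjugate \<phi> x \<le> convex_conjugate \<phi> (c * x) / c"
    by (rule convex_conjugate_least)
  then show ?thesis using assms(2) by (simp add: field_simps)
qed

text \<open>
  Since \<open>\<phi> y / y\<close> tends to \<open>0\<close> at the origin, some \<open>y > 0\<close> has \<open>\<phi> y < x * y\<close>.
\<close>

lemma convex_conjugate_pos:
  assumes "orlicz_N_function \<phi>" "0 < x"
  shows "0 < convex_conjugate \<phi> x"
proof -
  have "((\<lambda>y. \<phi> y / y) \<longlongrightarrow> 0) (at_right 0)"
    using assms(1) by (auto simp: orlicz_N_function_def intro: filterlim_mono at_le)
  then have "eventually (\<lambda>y. \<phi> y / y < x) (at_right 0)"
    using assms(2) by (rule order_tendstoD)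
  moreover have "eventually (\<lambda>y::real. 0 < y) (at_right 0)"
    by (rule eventually_at_right_less)
  ultimately have "eventually (\<lambda>y. \<phi> y / y < x \<and> 0 < y) (at_right 0)"
    by (rule eventually_conj)
  then obtain y where "\<phi> y / y < x" "0 < y"
    using eventually_happens'[OF trivial_limit_at_right_real] by blast
  then have "0 < x * y - \<phi> y" by (simp add: field_simps)
  also have "\<dots> \<le> convex_conjugate \<phi> x" by (rule convex_conjugate_upper[OF assms(1)])
  finally show ?thesis .
qed

lemma convex_conjugate_strict_mono:
  assumes "orlicz_N_function \<phi>"
  shows "strict_mono_on {0..} (convex_conjugate \<phi>)"
proof (rule strict_mono_onI)
  fix x y :: real
  assume xy: "x \<in> {0..}" "y \<in> {0..}" "x < y"
  show "convex_conjugate \<phi> x < convex_conjugate \<phi> y"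
  proof (cases "x = 0")
    case True
    then show ?thesis
      using convex_conjugate_pos[OF assms] xy convex_conjugate_0[OF assms] by simp
  next
    case False
    then have x: "0 < x" using xy by simp
    have "convex_conjugate \<phi> x < (y / x) * convex_conjugate \<phi> x"
      using convex_conjugate_pos[OF assms x] x xy by (simp add: field_simps)
    also have "\<dots> \<le> convex_conjugate \<phi> ((y / x) * x)"
      using x xy by (intro convex_conjugate_superhomogeneous[OF assms]) (simp add: field_simps)
    finally show ?thesis using x by simp
  qed
qed

lemma convex_conjugate_convex:
  assumes "orlicz_N_function \<phi>"
  shows "convex_on UNIV (convex_conjugate \<phi>)"
proof (rule convex_onI)
  fix t x y :: real
  assume t: "0 < t" "t < 1"
  show "convex_conjugate \<phi> ((1 - t) *\<^sub>R x + t *\<^sub>R y)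
      \<le> (1 - t) * convex_conjugate \<phi> x + t * convex_conjugate \<phi> y"
  proof (rule convex_conjugate_least)
    fix z
    have "((1 - t) *\<^sub>R x + t *\<^sub>R y) * z - \<phi> z = (1 - t) * (x * z - \<phi> z) + t * (y * z - \<phi> z)"
      by (simp add: algebra_simps)
    also have "\<dots> \<le> (1 - t) * convex_conjugate \<phi> x + t * convex_conjugate \<phi> y"
      using t by (intro add_mono mult_left_mono convex_conjugate_upper[OF assms]) auto
    finally show "((1 - t) *\<^sub>R x + t *\<^sub>R y) * z - \<phi> z
      \<le> (1 - t) * convex_conjugate \<phi> x + t * convex_conjugate \<phi> y" .
  qed
qed simp

text \<open>
  The conjugate is convex and finite, hence continuous; it vanishes at \<open>0\<close> and grows at least
  linearly beyond \<open>1\<close>, so the intermediate value theorem applies.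
\<close>

lemma convex_conjugate_surj:
  assumes "orlicz_N_function \<phi>" "0 \<le> v"
  shows "v \<in> convex_conjugate \<phi> ` {0..}"
proof -
  let ?p = "convex_conjugate \<phi> 1"
  have p: "0 < ?p" by (rule convex_conjugate_pos[OF assms(1)]) simp
  define c where "c = 1 + v / ?p"
  have c: "1 \<le> c" using p assms(2) by (simp add: c_def)
  have "v \<le> c * ?p" using p by (simp add: c_def field_simps)
  also have "\<dots> \<le> convex_conjugate \<phi> c"
    using convex_conjugate_superhomogeneous[OF assms(1) c, of 1] by simp
  finally have "v \<le> convex_conjugate \<phi> c" .
  moreover have "continuous_on {0..c} (convex_conjugate \<phi>)"
    using convex_on_continuous[OF open_UNIV convex_conjugate_convex[OF assms(1)]]
    by (rule continuous_on_subset) simp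
  ultimately obtain x where "0 \<le> x" "convex_conjugate \<phi> x = v"
    using IVT'[of "convex_conjugate \<phi>" 0 v c] c assms(2) convex_conjugate_0[OF assms(1)] by auto
  then show ?thesis by auto
qed

lemma conjugate_inv_spec:
  assumes "orlicz_N_function \<phi>" "0 \<le> v"
  shows "0 \<le> conjugate_inv \<phi> v" "convex_conjugate \<phi> (conjugate_inv \<phi> v) = v"
  using inv_into_into[OF convex_conjugate_surj[OF assms]]
    f_inv_into_f[OF convex_conjugate_surj[OF assms]]
  by (auto simp: conjugate_inv_def)

lemma conjugate_inv_pos:
  assumes "orlicz_N_function \<phi>" "0 < v"
  shows "0 < conjugate_inv \<phi> v"
  using conjugate_inv_spec[OF assms(1), of v] convex_conjugate_0[OF assms(1)] assms(2)
  by (metis less_eq_real_def less_irrefl)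

text \<open>
  The conjugate takes at \<open>2 * conjugate_inv \<phi> v\<close> a value of at least \<open>2 * v\<close>, and it is strictly
  increasing.
\<close>

lemma conjugate_inv_double:
  assumes "orlicz_N_function \<phi>" "0 \<le> v"
  shows "conjugate_inv \<phi> (2 * v) \<le> 2 * conjugate_inv \<phi> v"
proof (rule ccontr)
  note w = conjugate_inv_spec[OF assms] and w2 = conjugate_inv_spec[OF assms(1), of "2 * v"]
  assume "\<not> ?thesis"
  then have "convex_conjugate \<phi> (2 * conjugate_inv \<phi> v) < convex_conjugate \<phi> (conjugate_inv \<phi> (2 * v))"
    using w w2 assms(2)
    by (intro strict_mono_onD[OF convex_conjugate_strict_mono[OF assms(1)]]) auto
  moreover have "2 * convex_conjugate \<phi> (conjugate_inv \<phi> v) \<le> convex_conjugate \<phi> (2 * conjugate_inv \<phi> v)"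
    by (rule convex_conjugate_superhomogeneous[OF assms(1)]) simp
  ultimately show False using w w2 assms(2) by simp
qed

section \<open>Partitions from labels\<close>

definition fibres :: "'t set \<Rightarrow> ('t \<Rightarrow> 'b) \<Rightarrow> 't set set" where
  "fibres T f = (\<lambda>t. {s\<in>T. f s = f t}) ` T"

lemma partition_on_fibres: "partition_on T (fibres T f)"
  by (rule partition_onI) (auto simp: fibres_def disjnt_def)

lemma part_of_fibres:
  assumes "t \<in> T"
  shows "part_of (fibres T f) t = {s\<in>T. f s = f t}"
  unfolding part_of_def by (rule the_equality) (use assms in \<open>auto simp: fibres_def\<close>)

lemma card_fibres:
  assumes "finite (f ` T)"
  shows "finite (fibres T f)" "card (fibres T f) \<le> card (f ` T)"
proof -
  have eq: "fibres T f = (\<lambda>y. {s\<in>T. f s = y}) ` f ` T"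
    by (auto simp: fibres_def)
  show "finite (fibres T f)" "card (fibres T f) \<le> card (f ` T)"
    unfolding eq using assms by (auto intro: card_image_le)
qed

lemma refines_fibres:
  assumes "\<And>s t. f s = f t \<Longrightarrow> g s = g t"
  shows "refines T (fibres T f) (fibres T g)"
  unfolding refines_def
proof (intro conjI ballI partition_on_fibres)
  fix A assume "A \<in> fibres T f"
  then obtain t where "t \<in> T" "A = {s\<in>T. f s = f t}" by (auto simp: fibres_def)
  moreover have "{s\<in>T. f s = f t} \<subseteq> {s\<in>T. g s = g t}" using assms by blast
  ultimately show "\<exists>B\<in>fibres T g. A \<subseteq> B" unfolding fibres_def by blast
qed

text \<open>
  The record of the labels kept at level \<open>n\<close>: an initial label \<open>h\<close> from level \<open>k\<close> on, and the labels
  \<open>g m\<close> for \<open>k \<le> m \<le> n - 2\<close>. Levels below \<open>k\<close> distinguish nothing. The delay by two levels makes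
  room for labels \<open>g m\<close> with up to \<open>2 ^ 2 ^ (m + 1)\<close> values.
\<close>

definition history :: "nat \<Rightarrow> ('t \<Rightarrow> 'b) \<Rightarrow> (nat \<Rightarrow> 't \<Rightarrow> 'c) \<Rightarrow> nat \<Rightarrow> 't \<Rightarrow> ('b \<times> 'c list) option" where
  "history k h g n t = (if n < k then None else Some (h t, map (\<lambda>m. g m t) [k..<n - 1]))"

lemma history_Suc_determines:
  assumes "history k h g (Suc n) s = history k h g (Suc n) t"
  shows "history k h g n s = history k h g n t"
  using assms by (auto simp: history_def split: if_splits)

text \<open>
  The record at level \<open>n + 1\<close> is the one at level \<open>n\<close> extended by the label \<open>g (n - 1)\<close>, which takes
  at most \<open>2 ^ 2 ^ n\<close> values, and \<open>2 ^ 2 ^ n * 2 ^ 2 ^ n = 2 ^ 2 ^ (n + 1)\<close>.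
\<close>

lemma card_history:
  fixes h :: "'t \<Rightarrow> 'b" and g :: "nat \<Rightarrow> 't \<Rightarrow> 'c"
  assumes h: "finite (h ` T)" "card (h ` T) \<le> 2 ^ (2 ^ k)"
    and g: "\<And>m. m \<ge> k \<Longrightarrow> finite (g m ` T) \<and> card (g m ` T) \<le> 2 ^ (2 ^ Suc m)"
    and n: "k \<le> n"
  shows "finite (history k h g n ` T) \<and> card (history k h g n ` T) \<le> 2 ^ (2 ^ n)"
  using n
proof (induction n rule: dec_induct)
  case base
  have "history k h g k ` T = (\<lambda>x. Some (x, [])) ` h ` T"
    by (auto simp: history_def image_image)
  then show ?case
    using h order.trans[OF card_image_le[OF h(1)] h(2), of "\<lambda>x. Some (x, [])"] by simp
next
  case (step n)
  let ?H = "history k h g"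
  show ?case
  proof (cases "n = k")
    case True
    then have "?H (Suc n) = ?H n" by (auto simp: history_def fun_eq_iff)
    then show ?thesis using step.IH
      by (auto intro: order.trans[OF _ power_increasing])
  next
    case False
    then obtain m where m: "n = Suc m" "k \<le> m" using step.hyps by (cases n) auto
    note gm = g[OF m(2)]
    \<comment> \<open>\<open>f\<close> appends the new label to an old record.\<close>
    define f where "f p = map_option (\<lambda>(x, l). (x, l @ [snd p])) (fst p)" for p :: "('b \<times> 'c list) option \<times> 'c"
    have "?H (Suc n) t = f (?H n t, g m t)" for t
      using m by (auto simp: history_def f_def)
    then have sub: "?H (Suc n) ` T \<subseteq> f ` (?H n ` T \<times> g m ` T)" by auto
    have fin: "finite (?H n ` T \<times> g m ` T)" using step.IH gm by auto
    have "card (?H (Suc n) ` T) \<le> card (?H n ` T \<times> g m ` T)"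
      using card_mono[OF finite_imageI[OF fin] sub] card_image_le[OF fin, of f] by linarith
    also have "\<dots> \<le> 2 ^ (2 ^ n) * 2 ^ (2 ^ n)"
      unfolding card_cartesian_product using step.IH gm m by (intro mult_mono) auto
    also have "\<dots> = 2 ^ (2 ^ Suc n)" by (simp flip: power_add)
    finally show ?thesis using finite_subset[OF sub finite_imageI[OF fin]] by simp
  qed
qed

lemma admissible_history:
  assumes T: "T \<noteq> {}"
    and h: "finite (h ` T)" "card (h ` T) \<le> 2 ^ (2 ^ k)"
    and h0: "k = 0 \<Longrightarrow> card (h ` T) = 1"
    and g: "\<And>m. m \<ge> k \<Longrightarrow> finite (g m ` T) \<and> card (g m ` T) \<le> 2 ^ (2 ^ Suc m)"
  shows "admissible_sequence T (\<lambda>n. fibres T (history k h g n))"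
proof -
  let ?H = "history k h g"
  have small: "?H n ` T = {None}" if "n < k" for n
    using that T by (auto simp: history_def)
  have fin: "finite (?H n ` T)" and card: "card (?H n ` T) \<le> 2 ^ (2 ^ n)" for n
    using card_history[OF h g, of n] small[of n] by (cases "n < k"; simp)+
  have "card (fibres T (?H 0)) = 1"
  proof -
    have "card (?H 0 ` T) \<le> 1"
    proof (cases "k = 0")
      case True
      have "?H 0 ` T = (\<lambda>x. Some (x, [])) ` h ` T"
        using True by (auto simp: history_def image_image)
      then show ?thesis using h0[OF True] card_image_le[OF h(1), of "\<lambda>x. Some (x, [])"] by auto
    next
      case False
      then show ?thesis using small[of 0] by simp
    qed
    moreover have "fibres T (?H 0) \<noteq> {}" using T by (simp add: fibres_def)
    ultimately show ?thesis
      using card_fibres[OF fin, of 0] by (metis card_gt_0_iff le_antisym le_trans less_eq_Suc_le One_nat_def)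
  qed
  then show ?thesis
    unfolding admissible_sequence_def
    using card_fibres[OF fin] card
    by (auto simp: partition_on_fibres intro: refines_fibres history_Suc_determines order.trans)
qed

text \<open>
  The number \<open>j\<close> with \<open>R / 2 ^ (j + 1) < x \<le> R / 2 ^ j\<close>, truncated to the range \<open>0, \<dots>, N\<close>:
  all \<open>x > R / 2\<close> share scale \<open>0\<close> when \<open>N > 0\<close>, and all \<open>x \<le> R / 2 ^ N\<close> share scale \<open>N\<close>.
\<close>

definition dyadic_scale :: "real \<Rightarrow> nat \<Rightarrow> real \<Rightarrow> nat" where
  "dyadic_scale R N x = (LEAST j. j = N \<or> R / 2 ^ Suc j < x)"

lemma dyadic_scale_le: "dyadic_scale R N x \<le> N"
  unfolding dyadic_scale_def by (rule Least_le) simp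

lemma dyadic_scale_upper:
  assumes "dyadic_scale R N x \<noteq> 0"
  shows "x \<le> R / 2 ^ dyadic_scale R N x"
proof -
  obtain i where i: "dyadic_scale R N x = Suc i" using assms by (cases "dyadic_scale R N x") auto
  then have "\<not> (i = N \<or> R / 2 ^ Suc i < x)"
    unfolding dyadic_scale_def by (intro not_less_Least) simp
  then show ?thesis using i by auto
qed

text \<open>
  Numbers of equal scale agree up to a factor \<open>2\<close>, except for the two truncations: at scale \<open>0\<close>
  only \<open>R < 2 * x\<close> is known, which is why \<open>y\<close> is capped at \<open>R\<close>, and at scale \<open>N\<close> only
  \<open>y \<le> R / 2 ^ N\<close> (for \<open>N > 0\<close>), which is the additive error.
\<close>

lemma dyadic_scale_eq_imp_le:
  assumes eq: "dyadic_scale R N x = dyadic_scale R N y" and "0 \<le> R" "0 \<le> x"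
  shows "min y R \<le> 2 * x + R / 2 ^ N"
proof -
  let ?j = "dyadic_scale R N x"
  have up: "min y R \<le> R / 2 ^ ?j"
    using dyadic_scale_upper[of R N y] eq by (cases "?j = 0") auto
  have "?j = N \<or> R / 2 ^ Suc ?j < x"
    unfolding dyadic_scale_def by (rule LeastI[of _ N]) simp
  then show ?thesis
  proof
    assume "?j = N"
    then show ?thesis using up assms by simp
  next
    assume "R / 2 ^ Suc ?j < x"
    then have "R / 2 ^ ?j < 2 * x" by (simp add: field_simps)
    moreover have "0 \<le> R / 2 ^ N" using assms by simp
    ultimately show ?thesis using up by linarith
  qed
qed

section \<open>From points to partitions\<close>

lemma card_scale_labels: "2 * m + 1 \<le> 2 ^ (2 ^ m :: nat)" for m :: nat
proof -
  have m: "m + 1 \<le> 2 ^ m" by (metis Suc_eq_plus1 Suc_leI less_exp)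
  then have "2 * m + 1 \<le> 2 ^ (m + 1)" by simp
  also have "(2::nat) ^ (m + 1) \<le> 2 ^ (2 ^ m)" using m by (intro power_increasing) auto
  finally show ?thesis .
qed

lemma set_diam_le:
  assumes "\<And>s t. s \<in> S \<Longrightarrow> t \<in> S \<Longrightarrow> d s t \<le> B"
  shows "set_diam d S \<le> ennreal B"
  unfolding set_diam_def by (intro SUP_least ennreal_leI assms)

text \<open>
  The construction of cells from nearest points and distance scales. The bound \<open>38\<close> consists of
  \<open>6\<close> from the levels \<open>k\<close> and \<open>k + 1\<close>, whose cells are the Voronoi cells of \<open>U k\<close>; of \<open>16\<close> from the
  terms \<open>4 * d(t, U m)\<close>, with a factor \<open>4\<close> for the shift of the weights by two levels; and of \<open>16\<close>
  from the truncation of the scales.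
\<close>

lemma partition_from_points:
  fixes w :: "nat \<Rightarrow> real"
  assumes "Metric_space T d" and U: "admissible_points T U"
    and w: "\<And>n. 0 < w n" and w2: "\<And>n. w (Suc n) \<le> 2 * w n"
    and S: "S \<noteq> \<top>"
    and le: "\<And>t. t \<in> T \<Longrightarrow> (\<Sum>i. ennreal (w (i + k)) * dist_to_set d t (U (i + k))) \<le> S"
  obtains \<A> where "admissible_sequence T \<A>"
    and "\<And>t. t \<in> T \<Longrightarrow> (\<Sum>i. ennreal (w (i + k)) * set_diam d (part_of (\<A> (i + k)) t)) \<le> 38 * S"
proof -
  interpret Metric_space T d by fact
  have UT: "U n \<subseteq> T" for n using U by (simp add: admissible_points_def)
  have U0: "card (U 0) = 1" using U by (simp add: admissible_points_def)
  have finU: "finite (U n)" and cardU: "card (U n) \<le> 2 ^ (2 ^ n)" for n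
    using U U0 by (cases "n = 0"; auto simp: admissible_points_def intro: card_ge_0_finite)+
  have T: "T \<noteq> {}" using U0 UT[of 0] by auto
  have term_le: "ennreal (w (i + k)) * dist_to_set d t (U (i + k)) \<le> S" if "t \<in> T" for i t
    using sum_le_suminf[OF summableI, of "{i}" "\<lambda>i. ennreal (w (i + k)) * dist_to_set d t (U (i + k))"]
      le[OF that] by simp
  have Une: "U (i + k) \<noteq> {}" for i
  proof
    assume "U (i + k) = {}"
    moreover obtain t where "t \<in> T" using T by auto
    ultimately show False
      using term_le[of t i] S w[of "i + k"] by (simp add: dist_to_set_def ennreal_mult_top top_unique)
  qed

  \<comment> \<open>\<open>\<pi> m t\<close> is a nearest point of \<open>U m\<close>, and \<open>\<delta> m t\<close> the distance to it.\<close>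
  define \<pi> where "\<pi> m t = arg_min_on (d t) (U m)" for m t
  define \<delta> where "\<delta> m t = d t (\<pi> m t)" for m t
  have \<pi>: "\<pi> m t \<in> U m" "\<pi> m t \<in> T" and dist: "dist_to_set d t (U m) = ennreal (\<delta> m t)"
    if "k \<le> m" for m t
  proof -
    have ne: "U m \<noteq> {}" using Une[of "m - k"] that by simp
    show 1: "\<pi> m t \<in> U m" unfolding \<pi>_def by (rule arg_min_if_finite(1)[OF finU ne])
    then show "\<pi> m t \<in> T" using UT by auto
    have "\<delta> m t \<le> d t s" if "s \<in> U m" for s
      unfolding \<delta>_def \<pi>_def by (rule arg_min_least[OF finU ne that])
    then show "dist_to_set d t (U m) = ennreal (\<delta> m t)"
      unfolding dist_to_set_def using 1
      by (intro antisym INF_greatest INF_lower2[of "\<pi> m t"]) (auto simp: \<delta>_def intro: ennreal_leI)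
  qed
  have \<delta>0: "0 \<le> \<delta> m t" for m t by (simp add: \<delta>_def)
  \<comment> \<open>The first term of the sum is at most \<open>S\<close>, so \<open>R = S / w k\<close> bounds all distances to \<open>U k\<close>.\<close>
  obtain r where r: "S = ennreal r" "0 \<le> r" using S by (cases S) auto
  define R where "R = r / w k"
  have R0: "0 \<le> R" using r w[of k] by (simp add: R_def)
  have wR: "w k * R = r" using w[of k] by (simp add: R_def)
  have \<delta>R: "\<delta> k t \<le> R" if "t \<in> T" for t
  proof -
    have "ennreal (w k * \<delta> k t) \<le> ennreal r"
      using term_le[OF that, of 0] dist[of k] r w[of k] \<delta>0 by (simp add: ennreal_mult')
    then show ?thesis using r w[of k] by (simp add: R_def field_simps)
  qed

  \<comment> \<open>Truncation at scale \<open>2 * m\<close> leaves an error \<open>R / 4 ^ m\<close>, small enough to be summed against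
    \<open>w m \<le> 2 ^ (m - k) * w k\<close>.\<close>
  define g where "g m t = (\<pi> m t, dyadic_scale R (2 * m) (\<delta> m t))" for m t
  define \<A> where "\<A> n = fibres T (history k (\<pi> k) g n)" for n
  have hsub: "\<pi> k ` T \<subseteq> U k" using \<pi> by auto
  have adm: "admissible_sequence T \<A>"
    unfolding \<A>_def
  proof (rule admissible_history[OF T])
    show "finite (\<pi> k ` T)" using finite_subset[OF hsub finU] .
    show "card (\<pi> k ` T) \<le> 2 ^ (2 ^ k)" using card_mono[OF finU hsub] cardU[of k] by linarith
    show "card (\<pi> k ` T) = 1" if "k = 0"
    proof -
      have "card (\<pi> k ` T) \<noteq> 0" using T finite_subset[OF hsub finU] by simp
      then show ?thesis using card_mono[OF finU hsub] U0 that by simp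
    qed
    fix m assume m: "k \<le> m"
    have sub: "g m ` T \<subseteq> U m \<times> {..2 * m}" using \<pi>[OF m] dyadic_scale_le by (auto simp: g_def)
    have fin: "finite (U m \<times> {..2 * m})" using finU by simp
    have "card (g m ` T) \<le> card (U m) * (2 * m + 1)"
      using card_mono[OF fin sub] by (simp add: card_cartesian_product)
    also have "\<dots> \<le> 2 ^ (2 ^ m) * 2 ^ (2 ^ m)"
      by (intro mult_mono cardU card_scale_labels) auto
    also have "\<dots> = 2 ^ (2 ^ Suc m)" by (simp flip: power_add)
    finally show "finite (g m ` T) \<and> card (g m ` T) \<le> 2 ^ (2 ^ Suc m)"
      using finite_subset[OF sub fin] by simp
  qed

  have via: "d s s' \<le> \<delta> m s + \<delta> m s'"
    if "k \<le> m" "\<pi> m s = \<pi> m s'" "s \<in> T" "s' \<in> T" for m s s'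
    using triangle[OF that(3) \<pi>(2)[OF that(1), of s] that(4)] that(2) commute[of s']
    by (simp add: \<delta>_def)
  have coarse: "d s s' \<le> 2 * R" if "\<pi> k s = \<pi> k s'" "s \<in> T" "s' \<in> T" for s s'
    using via[of k s s'] that \<delta>R[of s] \<delta>R[of s'] by simp
  have diam_coarse: "set_diam d (part_of (\<A> n) t) \<le> ennreal (2 * R)" if "t \<in> T" "k \<le> n" for n t
    unfolding \<A>_def part_of_fibres[OF that(1)]
    by (rule set_diam_le, rule coarse) (use that in \<open>auto simp: history_def\<close>)
  have diam_fine: "set_diam d (part_of (\<A> (Suc (Suc m))) t) \<le> ennreal (4 * \<delta> m t + 2 * R / 4 ^ m)"
    if t: "t \<in> T" and m: "k \<le> m" for m t
    unfolding \<A>_def part_of_fibres[OF t]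
  proof (rule set_diam_le)
    let ?B = "2 * \<delta> m t + R / 2 ^ (2 * m)"
    fix s s'
    assume s: "s \<in> {s \<in> T. history k (\<pi> k) g (Suc (Suc m)) s = history k (\<pi> k) g (Suc (Suc m)) t}"
      and s': "s' \<in> {s \<in> T. history k (\<pi> k) g (Suc (Suc m)) s = history k (\<pi> k) g (Suc (Suc m)) t}"
    have lab: "\<pi> k x = \<pi> k t" "\<pi> m x = \<pi> m t" "dyadic_scale R (2 * m) (\<delta> m t) = dyadic_scale R (2 * m) (\<delta> m x)"
      if "history k (\<pi> k) g (Suc (Suc m)) x = history k (\<pi> k) g (Suc (Suc m)) t" for x
      using that m by (auto simp: history_def g_def)
    have T: "s \<in> T" "s' \<in> T" using s s' by simp_all
    have hist: "history k (\<pi> k) g (Suc (Suc m)) s = history k (\<pi> k) g (Suc (Suc m)) t"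
      "history k (\<pi> k) g (Suc (Suc m)) s' = history k (\<pi> k) g (Suc (Suc m)) t"
      using s s' by simp_all
    have "d s s' \<le> \<delta> m s + \<delta> m s'"
      by (rule via[OF m _ T]) (simp add: lab(2)[OF hist(1)] lab(2)[OF hist(2)])
    moreover have "d s s' \<le> 2 * R"
      by (rule coarse[OF _ T]) (simp add: lab(1)[OF hist(1)] lab(1)[OF hist(2)])
    moreover have "min (\<delta> m s) R \<le> ?B"
      by (rule dyadic_scale_eq_imp_le[OF lab(3)[OF hist(1)] R0 \<delta>0])
    moreover have "min (\<delta> m s') R \<le> ?B"
      by (rule dyadic_scale_eq_imp_le[OF lab(3)[OF hist(2)] R0 \<delta>0])
    \<comment> \<open>Either \<open>R \<le> ?B\<close> and the bound \<open>2 * R\<close> suffices, or both distances to \<open>U m\<close> are at most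
      \<open>?B\<close>.\<close>
    ultimately have "d s s' \<le> 2 * ?B" unfolding min_def by argo
    also have "\<dots> = 4 * \<delta> m t + 2 * R / 4 ^ m" by (simp add: power_mult)
    finally show "d s s' \<le> 4 * \<delta> m t + 2 * R / 4 ^ m" .
  qed

  have w4: "w (Suc (Suc n)) \<le> 4 * w n" for n using w2[of n] w2[of "Suc n"] by simp
  have wpow: "w (i + k) \<le> 2 ^ i * w k" for i
  proof (induction i)
    case (Suc i)
    then show ?case using w2[of "i + k"] by simp
  qed simp

  have "(\<Sum>i. ennreal (w (i + k)) * set_diam d (part_of (\<A> (i + k)) t)) \<le> 38 * S" if t: "t \<in> T" for t
  proof -
    let ?f = "\<lambda>i. ennreal (w (i + k)) * set_diam d (part_of (\<A> (i + k)) t)"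
    \<comment> \<open>The exponent \<open>Suc i\<close> makes the geometric series sum to \<open>1\<close>.\<close>
    have tail: "?f (i + 2) \<le> 16 * (ennreal (w (i + k)) * dist_to_set d t (U (i + k)))
        + ennreal (16 * r * (1/2) ^ Suc i)" for i
    proof -
      let ?m = "i + k"
      have "(2::real) ^ i * 2 ^ i = 4 ^ i" by (simp flip: power_mult_distrib)
      then have p: "(2::real) ^ i / 4 ^ i = (1/2) ^ i" by (simp add: power_divide field_simps)
      have a: "w ?m * (R / 4 ^ ?m) \<le> (2 ^ i * w k) * (R / 4 ^ i)"
        using R0 w[of k] wpow by (intro mult_mono divide_left_mono power_increasing) auto
      also have "\<dots> = r * (2 ^ i / 4 ^ i)" using wR by (simp add: algebra_simps)
      finally have a: "w ?m * (R / 4 ^ ?m) \<le> r * (1/2) ^ i" unfolding p .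
      have "w (Suc (Suc ?m)) * (4 * \<delta> ?m t + 2 * R / 4 ^ ?m)
          \<le> (4 * w ?m) * (4 * \<delta> ?m t + 2 * R / 4 ^ ?m)"
        using w4 \<delta>0 R0 by (intro mult_right_mono) auto
      also have "\<dots> = 16 * (w ?m * \<delta> ?m t) + 8 * (w ?m * (R / 4 ^ ?m))" by (simp add: algebra_simps)
      also have "\<dots> \<le> 16 * (w ?m * \<delta> ?m t) + 16 * r * (1/2) ^ Suc i" using a by simp
      finally have b: "w (Suc (Suc ?m)) * (4 * \<delta> ?m t + 2 * R / 4 ^ ?m)
          \<le> 16 * (w ?m * \<delta> ?m t) + 16 * r * (1/2) ^ Suc i" .
      have "?f (i + 2) = ennreal (w (Suc (Suc ?m))) * set_diam d (part_of (\<A> (Suc (Suc ?m))) t)"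
        by simp
      also have "\<dots> \<le> ennreal (w (Suc (Suc ?m))) * ennreal (4 * \<delta> ?m t + 2 * R / 4 ^ ?m)"
        by (intro mult_left_mono diam_fine t) auto
      also have "\<dots> = ennreal (w (Suc (Suc ?m)) * (4 * \<delta> ?m t + 2 * R / 4 ^ ?m))"
        using w[of "Suc (Suc ?m)"] by (simp add: ennreal_mult')
      also have "\<dots> \<le> ennreal (16 * (w ?m * \<delta> ?m t) + 16 * r * (1/2) ^ Suc i)"
        by (rule ennreal_leI[OF b])
      also have "\<dots> = ennreal (16 * (w ?m * \<delta> ?m t)) + ennreal (16 * r * (1/2) ^ Suc i)"
        using w[of ?m] \<delta>0[of ?m t] r by (intro ennreal_plus) auto
      also have "ennreal (16 * (w ?m * \<delta> ?m t)) = 16 * (ennreal (w ?m) * dist_to_set d t (U ?m))"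
        using w[of ?m] \<delta>0[of ?m t] by (simp add: dist ennreal_mult')
      finally show ?thesis .
    qed
    have geo: "(\<Sum>i. ennreal (16 * r * (1/2) ^ Suc i)) = ennreal (16 * r)"
      using sums_mult[OF power_half_series, of "16 * r"] r(2) by (intro suminf_ennreal_eq) auto
    have head: "?f 0 + ?f 1 \<le> 6 * S"
    proof -
      have "?f 0 + ?f 1 \<le> ennreal (w k) * ennreal (2 * R) + ennreal (w (Suc k)) * ennreal (2 * R)"
        using diam_coarse[OF t] by (intro add_mono mult_mono) auto
      also have "\<dots> = ennreal (w k * (2 * R) + w (Suc k) * (2 * R))"
        using w[of k] w[of "Suc k"] R0 by (simp add: ennreal_mult' ennreal_plus)
      also have "\<dots> \<le> ennreal (6 * r)"
      proof (rule ennreal_leI)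
        have "w (Suc k) * (2 * R) \<le> (2 * w k) * (2 * R)"
          using w2[of k] R0 by (intro mult_right_mono) auto
        then show "w k * (2 * R) + w (Suc k) * (2 * R) \<le> 6 * r" using wR by (simp add: algebra_simps)
      qed
      also have "\<dots> = 6 * S" using r by (simp add: ennreal_mult')
      finally show ?thesis .
    qed
    have "(\<Sum>i. ?f (i + 2)) \<le> (\<Sum>i. 16 * (ennreal (w (i + k)) * dist_to_set d t (U (i + k)))
        + ennreal (16 * r * (1/2) ^ Suc i))"
      by (intro suminf_le summableI tail)
    also have "\<dots> = 16 * (\<Sum>i. ennreal (w (i + k)) * dist_to_set d t (U (i + k))) + ennreal (16 * r)"
      unfolding geo[symmetric] ennreal_suminf_cmult[symmetric] by (intro suminf_add[symmetric] summableI)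
    also have "\<dots> \<le> 16 * S + 16 * S"
      using r le[OF t] by (intro add_mono mult_left_mono) (auto simp: ennreal_mult')
    finally have tails: "(\<Sum>i. ?f (i + 2)) \<le> 16 * S + 16 * S" .
    have "(\<Sum>i. ?f i) = (\<Sum>i. ?f (i + 2)) + (\<Sum>i<2. ?f i)"
      by (rule suminf_offset) (rule summableI)
    also have "(\<Sum>i<2. ?f i) = ?f 0 + ?f 1" by (simp add: numeral_2_eq_2)
    also have "(\<Sum>i. ?f (i + 2)) + (?f 0 + ?f 1) \<le> 16 * S + 16 * S + 6 * S"
      by (rule add_mono[OF tails head])
    also have "\<dots> = 38 * S" by (simp flip: distrib_right)
    finally show ?thesis .
  qed
  with adm show ?thesis by (rule that)
qed

lemma ennreal_le_mult_INF:
  fixes x :: ennreal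
  assumes "0 < C" and "\<And>i. i \<in> I \<Longrightarrow> x \<le> ennreal C * f i"
  shows "x \<le> ennreal C * (INF i\<in>I. f i)"
proof -
  have "x / ennreal C \<le> (INF i\<in>I. f i)"
    using assms by (intro INF_greatest divide_le_posI_ennreal) auto
  then have "ennreal C * (x / ennreal C) \<le> ennreal C * (INF i\<in>I. f i)"
    by (rule mult_left_mono) simp
  moreover have "ennreal C * (x / ennreal C) = x"
    using assms(1) by (simp add: ennreal_times_divide mult.commute mult_divide_eq_ennreal)
  ultimately show ?thesis by simp
qed

text \<open>
  A family of point sets with infinite sum imposes no condition; every other one yields a partition
  sequence by the construction above.
\<close>

lemma gamma_part_le_gamma_points:
  assumes "orlicz_N_function \<phi>" "Metric_space T d"
  shows "gamma_part \<phi> p T d \<le> ennreal 38 * gamma_points \<phi> p T d"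
  unfolding gamma_points_def
proof (rule ennreal_le_mult_INF)
  let ?w = "\<lambda>n::nat. conjugate_inv \<phi> (2 ^ n)" and ?k = "start_index p"
  fix U assume "U \<in> {U. admissible_points T U}"
  then have U: "admissible_points T U" by simp
  define S where "S = (SUP t\<in>T. \<Sum>i. let n = i + ?k in ennreal (?w n) * dist_to_set d t (U n))"
  have "gamma_part \<phi> p T d \<le> ennreal 38 * S"
  proof (cases "S = \<top>")
    case True
    then show ?thesis by (simp add: ennreal_mult_top)
  next
    case False
    have le: "(\<Sum>i. ennreal (?w (i + ?k)) * dist_to_set d t (U (i + ?k))) \<le> S" if "t \<in> T" for t
      unfolding S_def Let_def by (rule SUP_upper[OF that])
    have w: "0 < ?w n" "?w (Suc n) \<le> 2 * ?w n" for n
      using conjugate_inv_pos[OF assms(1)] conjugate_inv_double[OF assms(1), of "2 ^ n"] by auto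
    obtain \<A> where "admissible_sequence T \<A>"
      "\<And>t. t \<in> T \<Longrightarrow> (\<Sum>i. ennreal (?w (i + ?k)) * set_diam d (part_of (\<A> (i + ?k)) t)) \<le> 38 * S"
      using partition_from_points[OF assms(2) U w False le] by blast
    then show ?thesis
      unfolding gamma_part_def Let_def by (intro INF_lower2[of \<A>] SUP_least) auto
  qed
  then show "gamma_part \<phi> p T d
      \<le> ennreal 38 * (SUP t\<in>T. \<Sum>i. let n = i + ?k in ennreal (?w n) * dist_to_set d t (U n))"
    unfolding S_def .
qed simp

section \<open>From partitions to points\<close>

lemma part_of_mem:
  assumes "partition_on T P" "t \<in> T"
  shows "part_of P t \<in> P" "t \<in> part_of P t"
proof -
  have "\<exists>!S. S \<in> P \<and> t \<in> S"
    using assms by (auto simp: partition_on_def pairwise_def disjnt_def)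
  then show "part_of P t \<in> P" "t \<in> part_of P t"
    unfolding part_of_def by (simp_all add: theI'[of "\<lambda>S. S \<in> P \<and> t \<in> S"])
qed

text \<open>
  A point chosen in each cell \<open>A n t\<close> is at distance at most \<open>\<Delta>(A n t)\<close> from \<open>t\<close>, and there are
  no more such points than cells; in particular exactly one at level \<open>0\<close>.
\<close>

lemma gamma_points_le_gamma_part: "gamma_points \<phi> p T d \<le> gamma_part \<phi> p T d"
  unfolding gamma_part_def
proof (rule INF_greatest)
  fix \<A> assume "\<A> \<in> {\<A>. admissible_sequence T \<A>}"
  then have P: "\<And>n. partition_on T (\<A> n)" and c0: "card (\<A> 0) = 1"
    and c: "\<And>n. n \<ge> 1 \<Longrightarrow> finite (\<A> n) \<and> card (\<A> n) \<le> 2 ^ (2 ^ n)"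
    by (auto simp: admissible_sequence_def)
  define e :: "'a set \<Rightarrow> 'a" where "e A = (SOME a. a \<in> A)" for A
  have e: "e A \<in> A" if "A \<in> \<A> n" for A n
    using P[of n] that unfolding e_def by (intro some_in_eq[THEN iffD2]) (auto simp: partition_on_def)
  define U where "U n = e ` \<A> n" for n
  obtain A where "\<A> 0 = {A}" using c0 by (auto simp: card_1_singleton_iff)
  then have U0: "card (U 0) = 1" by (simp add: U_def)
  have "U n \<subseteq> T" for n using e P[of n] by (auto simp: U_def partition_on_def)
  moreover have "finite (U n) \<and> card (U n) \<le> 2 ^ (2 ^ n)" if "n \<ge> 1" for n
    using c[OF that] card_image_le[of "\<A> n" e] by (auto simp: U_def)
  ultimately have U: "admissible_points T U"
    using U0 by (simp add: admissible_points_def)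
  have le: "dist_to_set d t (U n) \<le> set_diam d (part_of (\<A> n) t)" if "t \<in> T" for t n
  proof -
    note A = part_of_mem[OF P[of n] that]
    have "dist_to_set d t (U n) \<le> ennreal (d t (e (part_of (\<A> n) t)))"
      unfolding dist_to_set_def U_def using A by (intro INF_lower) auto
    also have "\<dots> \<le> set_diam d (part_of (\<A> n) t)"
      unfolding set_diam_def using A e[OF A(1)] by (intro SUP_upper2[of t] SUP_upper) auto
    finally show ?thesis .
  qed
  show "gamma_points \<phi> p T d \<le> (SUP t\<in>T. \<Sum>k. let n = k + start_index p in
      ennreal (conjugate_inv \<phi> (2 ^ n)) * set_diam d (part_of (\<A> n) t))"
    unfolding gamma_points_def Let_def using U
    by (intro INF_lower2[of U] SUP_subset_mono suminf_le mult_left_mono le) auto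
qed

theorem theorem3p16:
  shows "\<exists>C>0::real. \<exists>C'>0::real.
    \<forall>(\<phi> :: real \<Rightarrow> real) (M :: 'a measure) (T :: 't set) (X :: 't \<Rightarrow> 'a \<Rightarrow> real) (p :: real).
      orlicz_N_function \<phi> \<longrightarrow> Q_condition \<phi> \<longrightarrow> Delta2_condition \<phi> \<longrightarrow>
      prob_space M \<longrightarrow> subgaussian_process \<phi> M T X \<longrightarrow>
      Metric_space T (process_dist \<phi> M T X) \<longrightarrow> 1 \<le> p \<longrightarrow>
        gamma_part \<phi> p T (process_dist \<phi> M T X)
          \<le> ennreal C * gamma_points \<phi> p T (process_dist \<phi> M T X) \<and>
        gamma_points \<phi> p T (process_dist \<phi> M T X)
          \<le> ennreal C' * gamma_part \<phi> p T (process_dist \<phi> M T X)"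
proof (rule exI[of _ 38], intro conjI)
  show "\<exists>C'>0::real.
    \<forall>(\<phi> :: real \<Rightarrow> real) (M :: 'a measure) (T :: 't set) (X :: 't \<Rightarrow> 'a \<Rightarrow> real) (p :: real).
      orlicz_N_function \<phi> \<longrightarrow> Q_condition \<phi> \<longrightarrow> Delta2_condition \<phi> \<longrightarrow>
      prob_space M \<longrightarrow> subgaussian_process \<phi> M T X \<longrightarrow>
      Metric_space T (process_dist \<phi> M T X) \<longrightarrow> 1 \<le> p \<longrightarrow>
        gamma_part \<phi> p T (process_dist \<phi> M T X)
          \<le> ennreal 38 * gamma_points \<phi> p T (process_dist \<phi> M T X) \<and>
        gamma_points \<phi> p T (process_dist \<phi> M T X)
          \<le> ennreal C' * gamma_part \<phi> p T (process_dist \<phi> M T X)"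
    by (rule exI[of _ 1]) (auto intro: gamma_part_le_gamma_points simp: gamma_points_le_gamma_part simp del: ennreal_numeral)
qed simp

end
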